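(* Let $G$ be a 2-dd in which every alternating cycle has exactly six arcs, let $C$ be its set of alternating cycles, and suppose that $G$ is connected, odd and non-Hamiltonian. Then, for any open alternating cycle $X\in C$, $\overline{X}=C\setminus\{X\}$ is closed.
   Context: Digraphs are finite; arcs are ordered pairs $(u,v)$ of vertices ($u$ the start-vertex, $v$ the end-vertex); loops are allowed. For a vertex $v$, $v_{in}$ and $v_{out}$ are the sets of arcs with end-vertex $v$, respectively start-vertex $v$ (a loop belongs to both). A 2-digraph is a digraph in which every vertex $v$ satisfies $(|v_{in}|,|v_{out}|)\in\{(2,0),(0,2),(2,2)\}$; $v$ is called an exit, entry or saturated vertex respectively. A 2-dd is a 2-digraph all of whose vertices are saturated. Connected means that the underlying undirected graph is connected. A 2-dd is Hamiltonian if it has a directed cycle through all its vertices. An alternating cycle (AC) of a 2-digraph is a sequence $(e_0,\dots,e_{2r-1})$ of $2r$ distinct arcs such that, with indices mod $2r$, $e_i$ and $e_{i+1}$ have a common end-vertex if $i$ is even and a common start-vertex if $i$ is odd. The arcs of a 2-digraph $G$ are uniquely partitioned into ACs; $C$ denotes the set of ACs. For nonempty $K\subseteq C$, $G^K$ is the subgraph consisting of the arcs of the ACs in $K$ and their incident vertices; it is a 2-digraph. A factor $F$ of a 2-digraph is a spanning subgraph containing exactly one arc of $v_{in}$ for each vertex $v$ with $v_{in}\ne\emptyset$ and exactly one arc of $v_{out}$ for each $v$ with $v_{out}\neq\emptyset$; it is a disjoint union of simple cycles (a loop counts as a cycle) and simple paths from entry vertices to exit vertices. The index $i(F)$ is the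 number of cycles of $F$; $F$ is open if $i(F)=0$ and closed otherwise. A 2-digraph is closed if all of its factors are closed, and open otherwise; $K\subseteq C$ is called closed (open) if $G^K$ is, and an AC $X$ is called open if $G^{\{X\}}$ is. A 2-dd is odd if $i(F)$ is odd for every factor $F$ of it. *)

theory Defs
  imports "Graph_Theory.Digraph_Component"
begin

definition exit_vertex :: "'a pair_pre_digraph \<Rightarrow> 'a \<Rightarrow> bool" where
  "exit_vertex G v \<longleftrightarrow> in_degree G v = 2 \<and> out_degree G v = 0"

definition entry_vertex :: "'a pair_pre_digraph \<Rightarrow> 'a \<Rightarrow> bool" where
  "entry_vertex G v \<longleftrightarrow> in_degree G v = 0 \<and> out_degree G v = 2"

definition saturated_vertex :: "'a pair_pre_digraph \<Rightarrow> 'a \<Rightarrow> bool" where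
  "saturated_vertex G v \<longleftrightarrow> in_degree G v = 2 \<and> out_degree G v = 2"

locale two_digraph = pair_fin_digraph G for G :: "'a pair_pre_digraph" +
  assumes vertex_types:
    "v \<in> pverts G \<Longrightarrow> exit_vertex G v \<or> entry_vertex G v \<or> saturated_vertex G v"

locale two_dd = two_digraph G for G :: "'a pair_pre_digraph" +
  assumes all_saturated: "v \<in> pverts G \<Longrightarrow> saturated_vertex G v"

definition Hamiltonian :: "'a pair_pre_digraph \<Rightarrow> bool" where
  "Hamiltonian G \<longleftrightarrow>
     (\<exists>p. pre_digraph.cycle G p \<and> (\<forall>v \<in> pverts G. \<exists>e \<in> set p. fst e = v))"

text \<open>Indices are taken modulo the length of the sequence, and the empty sequence is excluded.\<close>

definition alternating_cycle :: "'a pair_pre_digraph \<Rightarrow> ('a \<times> 'a) list \<Rightarrow> bool" where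
  "alternating_cycle G es \<longleftrightarrow>
     es \<noteq> [] \<and> even (length es) \<and> distinct es \<and> set es \<subseteq> parcs G \<and>
     (\<forall>i < length es.
        if even i then snd (es ! i) = snd (es ! (Suc i mod length es))
        else fst (es ! i) = fst (es ! (Suc i mod length es)))"

text \<open>As blocks of the partition of the arcs, alternating cycles are identified with their sets of
  arcs, so that sequences differing only by their starting point or direction count once.\<close>

definition ACs :: "'a pair_pre_digraph \<Rightarrow> ('a \<times> 'a) set set" where
  "ACs G = set ` {es. alternating_cycle G es}"

text \<open>The subgraph formed by the arcs of the alternating cycles in \<open>K\<close> and their incident
  vertices; it does not depend on the ambient digraph.\<close>

definition AC_subgraph :: "('a \<times> 'a) set set \<Rightarrow> 'a pair_pre_digraph" where
  "AC_subgraph K = \<lparr> pverts = fst ` \<Union>K \<union> snd ` \<Union>K, parcs = \<Union>K \<rparr>"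

definition factor :: "'a pair_pre_digraph \<Rightarrow> 'a pair_pre_digraph \<Rightarrow> bool" where
  "factor G F \<longleftrightarrow> spanning F G \<and>
     (\<forall>v \<in> pverts G.
        (in_arcs G v \<noteq> {} \<longrightarrow> (\<exists>!e. e \<in> in_arcs G v \<and> e \<in> parcs F)) \<and>
        (out_arcs G v \<noteq> {} \<longrightarrow> (\<exists>!e. e \<in> out_arcs G v \<and> e \<in> parcs F)))"

text \<open>\<^const>\<open>pre_digraph.cycle\<close> describes a cycle as a list of arcs with a starting point; passing
  to the set of arcs counts each cycle once.\<close>

definition factor_index :: "'a pair_pre_digraph \<Rightarrow> nat" where
  "factor_index F = card (set ` {p. pre_digraph.cycle F p})"

definition open_factor :: "'a pair_pre_digraph \<Rightarrow> bool" where
  "open_factor F \<longleftrightarrow> factor_index F = 0"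

definition closed_two_digraph :: "'a pair_pre_digraph \<Rightarrow> bool" where
  "closed_two_digraph G \<longleftrightarrow> (\<forall>F. factor G F \<longrightarrow> \<not> open_factor F)"

definition closed_ACs :: "('a \<times> 'a) set set \<Rightarrow> bool" where
  "closed_ACs K \<longleftrightarrow> closed_two_digraph (AC_subgraph K)"

definition open_AC :: "('a \<times> 'a) set \<Rightarrow> bool" where
  "open_AC X \<longleftrightarrow> \<not> closed_ACs {X}"

definition odd_two_dd :: "'a pair_pre_digraph \<Rightarrow> bool" where
  "odd_two_dd G \<longleftrightarrow> (\<forall>F. factor G F \<longrightarrow> odd (factor_index F))"

end

theory Submission
  imports Defs "HOL-Combinatorics.Orbits"
begin

text \<open>Suppose \<open>P\<close> is an open factor on the complement of \<open>X\<close>. Then \<open>P\<close> consists of three (possibly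
  trivial) paths from the heads \<open>b\<^sub>i\<close> to the tails \<open>a\<^sub>j\<close> of the arcs of \<open>X\<close>, and adding either of the two
  perfect matchings of the hexagon \<open>X\<close> gives a factor of \<open>G\<close> in which every cycle uses one of the
  three added arcs. Its index is at most three, odd, and not one since \<open>G\<close> is not Hamiltonian; so
  each added arc lies on a cycle of its own, which means that the path from its head ends at its
  tail. The two matchings give \<open>b\<^sub>1\<close> different partners, but the path from \<open>b\<^sub>1\<close> has only one end.\<close>

section \<open>Alternating cycles\<close>

lemma card_2_cases:
  assumes "card S = 2" "x \<in> S" "y \<in> S" "x \<noteq> y" "z \<in> S"
  shows "z = x \<or> z = y"
  using assms by (auto simp: card_2_iff)

text \<open>In a two-element fibre every arc has exactly one partner. Taken for \<open>snd\<close>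
  and for \<open>fst\<close>, these partner maps are the two kinds of move along an alternating
  cycle.\<close>

lemma fibre_partner_involution:
  assumes "\<And>e. e \<in> E \<Longrightarrow> card {d \<in> E. f d = f e} = 2"
  obtains h where "\<And>e. e \<in> E \<Longrightarrow> h e \<in> E" "\<And>e. e \<in> E \<Longrightarrow> h e \<noteq> e"
    "\<And>e. e \<in> E \<Longrightarrow> f (h e) = f e" "\<And>e. e \<in> E \<Longrightarrow> h (h e) = e"
proof -
  have "\<exists>d. d \<in> E \<and> d \<noteq> e \<and> f d = f e" if "e \<in> E" for e
  proof -
    from assms[OF that] obtain x y where "{d \<in> E. f d = f e} = {x, y}" "x \<noteq> y"
      by (auto simp: card_2_iff)
    then have "x \<in> {d \<in> E. f d = f e}" "y \<in> {d \<in> E. f d = f e}" "x \<noteq> e \<or> y \<noteq> e"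
      by auto
    then show ?thesis by auto
  qed
  then obtain h where h: "\<And>e. e \<in> E \<Longrightarrow> h e \<in> E \<and> h e \<noteq> e \<and> f (h e) = f e"
    by metis
  have "h (h e) = e" if "e \<in> E" for e
    using card_2_cases[OF assms[OF that], of e "h e" "h (h e)"] h[OF that] h[of "h e"] that
    by auto
  with h show thesis using that by blast
qed

text \<open>With \<open>h\<close> swapping at heads and \<open>t\<close> at tails, a step from an
  even index keeps the head, matching the parity convention of
  \<open>alternating_cycle\<close>.\<close>

primrec alternate :: "('a \<Rightarrow> 'a) \<Rightarrow> ('a \<Rightarrow> 'a) \<Rightarrow> 'a \<Rightarrow> nat \<Rightarrow> 'a" where
  "alternate h t x 0 = x"
| "alternate h t x (Suc n) = (if even n then h else t) (alternate h t x n)"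

text \<open>Finiteness forces a repetition. Each step is undone by the involution that made it, so
  the repetition can be pulled back to index 0; the absence of fixed points makes the period
  even.\<close>

lemma alternate_closes_up:
  assumes "finite E" "x \<in> E"
    and h: "\<And>e. e \<in> E \<Longrightarrow> h e \<in> E" "\<And>e. e \<in> E \<Longrightarrow> h e \<noteq> e" "\<And>e. e \<in> E \<Longrightarrow> h (h e) = e"
    and t: "\<And>e. e \<in> E \<Longrightarrow> t e \<in> E" "\<And>e. e \<in> E \<Longrightarrow> t e \<noteq> e" "\<And>e. e \<in> E \<Longrightarrow> t (t e) = e"
  obtains L where "0 < L" "even L" "alternate h t x L = x" "inj_on (alternate h t x) {..<L}"
proof -
  let ?s = "alternate h t x"
  have s_in: "?s n \<in> E" for n
    by (induction n) (auto simp: assms)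
  have s_back: "?s n = (if even n then h else t) (?s (Suc n))" for n
    using s_in[of n] by (simp add: h t)
  \<comment> \<open>Across an odd gap the first and the last step use the same involution. Peeling
    off both shortens the gap by 2, until two consecutive entries agree and yield a fixed
    point.\<close>
  have even_diff: "even d" if "?s i = ?s (i + d)" for i d
    using that
  proof (induction d arbitrary: i rule: less_induct)
    case (less d)
    show ?case
    proof (rule ccontr)
      assume "odd d"
      then obtain k where k: "d = Suc (2 * k)" by (auto elim: oddE)
      show False
      proof (cases k)
        case 0
        have "?s (Suc i) \<noteq> ?s i"
          using h(2)[OF s_in[of i]] t(2)[OF s_in[of i]] by simp
        then show False using less.prems k 0 by (simp del: alternate.simps)
      next
        case (Suc k')
        have "?s (Suc i) = (if even i then h else t) (?s (i + d))"
          using less.prems by simp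
        also have "\<dots> = ?s (i + 2 * k)"
          using s_back[of "i + 2 * k"] k by simp
        also have "i + 2 * k = Suc i + Suc (2 * k')" using Suc by simp
        finally have "even (Suc (2 * k'))"
          by (intro less.IH[of "Suc (2 * k')" "Suc i"]) (use Suc k in auto)
        then show False by simp
      qed
    qed
  qed
  \<comment> \<open>As the gap is even, both entries were reached by the same involution, so both
    can move back one index.\<close>
  have shift: "?s 0 = ?s d" if "?s i = ?s (i + d)" for i d
    using that
  proof (induction i)
    case (Suc i)
    have "even d" using even_diff Suc.prems by blast
    then have "?s i = ?s (i + d)"
      using s_back[of i] s_back[of "i + d"] Suc.prems by simp
    then show ?case by (rule Suc.IH)
  qed simp
  have "\<not> inj ?s"
    using s_in \<open>finite E\<close> by (meson finite_subset image_subsetI infinite_UNIV_nat finite_imageD)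
  then obtain i j where "i < j" "?s i = ?s j"
    by (metis injI linorder_neqE_nat)
  then have ex: "\<exists>L>0. ?s L = x"
    using shift[of i "j - i"] by (intro exI[of _ "j - i"]) auto
  define L where "L = (LEAST L. 0 < L \<and> ?s L = x)"
  have L: "0 < L" "?s L = x"
    using LeastI_ex[of "\<lambda>L. 0 < L \<and> ?s L = x"] ex unfolding L_def by auto
  \<comment> \<open>A repetition below \<open>L\<close> would pull back to a positive return time
    smaller than the least one.\<close>
  have "i = j" if "i \<le> j" "j < L" "?s i = ?s j" for i j
  proof (rule ccontr)
    assume "i \<noteq> j"
    then have "0 < j - i \<and> ?s (j - i) = x" using shift[of i "j - i"] that by auto
    then have "L \<le> j - i" unfolding L_def by (rule Least_le)
    with \<open>j < L\<close> show False by simp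
  qed
  then have "inj_on ?s {..<L}"
    by (intro inj_onI) (metis lessThan_iff linorder_le_cases)
  with L even_diff[of 0 L] show thesis using that by simp
qed

context two_dd
begin

lemma card_in_fibre: "e \<in> parcs G \<Longrightarrow> card {d \<in> parcs G. snd d = snd e} = 2"
  using all_saturated[OF arc_snd_in_verts, of e]
  by (simp add: saturated_vertex_def in_degree_def in_arcs_def)

lemma card_out_fibre: "e \<in> parcs G \<Longrightarrow> card {d \<in> parcs G. fst d = fst e} = 2"
  using all_saturated[OF arc_fst_in_verts, of e]
  by (simp add: saturated_vertex_def out_degree_def out_arcs_def)

lemma in_arcs_nonempty: "v \<in> pverts G \<Longrightarrow> in_arcs G v \<noteq> {}"
  and out_arcs_nonempty: "v \<in> pverts G \<Longrightarrow> out_arcs G v \<noteq> {}"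
  using all_saturated[of v] by (auto simp: saturated_vertex_def in_degree_def out_degree_def)

text \<open>Swapping alternately at heads and at tails, starting from \<open>e\<close>, closes up
  into an alternating cycle.\<close>

lemma arc_in_AC:
  assumes "e \<in> parcs G"
  shows "\<exists>A \<in> ACs G. e \<in> A"
proof -
  obtain h where h: "\<And>d. d \<in> parcs G \<Longrightarrow> h d \<in> parcs G" "\<And>d. d \<in> parcs G \<Longrightarrow> h d \<noteq> d"
    "\<And>d. d \<in> parcs G \<Longrightarrow> snd (h d) = snd d" "\<And>d. d \<in> parcs G \<Longrightarrow> h (h d) = d"
    using fibre_partner_involution[of "parcs G" snd] card_in_fibre by blast
  obtain t where t: "\<And>d. d \<in> parcs G \<Longrightarrow> t d \<in> parcs G" "\<And>d. d \<in> parcs G \<Longrightarrow> t d \<noteq> d"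
    "\<And>d. d \<in> parcs G \<Longrightarrow> fst (t d) = fst d" "\<And>d. d \<in> parcs G \<Longrightarrow> t (t d) = d"
    using fibre_partner_involution[of "parcs G" fst] card_out_fibre by blast
  let ?s = "alternate h t e"
  obtain L where L: "0 < L" "even L" "?s L = e" "inj_on ?s {..<L}"
    using alternate_closes_up[of "parcs G" e h t] pair_finite_arcs assms h t by blast
  have s_in: "?s n \<in> parcs G" for n
    by (induction n) (auto simp: assms h t)
  \<comment> \<open>The index wraps around only at \<open>i = L - 1\<close>, where
    \<open>?s L = e = ?s 0\<close>.\<close>
  have wrap: "?s (Suc i mod L) = ?s (Suc i)" if "i < L" for i
    using that L by (cases "Suc i = L") (auto simp del: alternate.simps(2))
  have "alternating_cycle G (map ?s [0..<L])"
    unfolding alternating_cycle_def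
    using L s_in by (auto simp: wrap h t distinct_map atLeast0LessThan nth_append)
  moreover have "e \<in> set (map ?s [0..<L])"
    using L(1) by (auto intro!: image_eqI[of _ _ 0])
  ultimately show ?thesis unfolding ACs_def by blast
qed

text \<open>Coordinates for a hexagon: the \<open>a\<close>s are its tails and the \<open>b\<close>s
  its heads, with the arcs in cyclic order. A tail may also be a head, so distinctness is claimed
  only within each triple.\<close>

lemma AC_hexagon:
  assumes "A \<in> ACs G" "card A = 6"
  obtains a1 a2 a3 b1 b2 b3 where "distinct [a1, a2, a3]" "distinct [b1, b2, b3]"
    "A = {(a3, b1), (a1, b1), (a1, b2), (a2, b2), (a2, b3), (a3, b3)}" "A \<subseteq> parcs G"
proof -
  obtain es where es: "alternating_cycle G es" "A = set es"
    using assms(1) unfolding ACs_def by auto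
  then have len: "length es = 6"
    using assms(2) by (auto simp: alternating_cycle_def distinct_card)
  then obtain e0 e1 e2 e3 e4 e5 where es_eq: "es = [e0, e1, e2, e3, e4, e5]"
    by (auto simp: length_Suc_conv eval_nat_numeral)
  have alt: "if even i then snd (es ! i) = snd (es ! (Suc i mod 6))
        else fst (es ! i) = fst (es ! (Suc i mod 6))" if "i < 6" for i
    using es(1) that len unfolding alternating_cycle_def by auto
  have ends: "snd e0 = snd e1" "fst e1 = fst e2" "snd e2 = snd e3" "fst e3 = fst e4"
    "snd e4 = snd e5" "fst e5 = fst e0"
    using alt[of 0] alt[of 1] alt[of 2] alt[of 3] alt[of 4] alt[of 5]
    by (simp_all add: es_eq)
  have dist: "distinct [e0, e1, e2, e3, e4, e5]" and sub: "A \<subseteq> parcs G"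
    using es es_eq by (auto simp: alternating_cycle_def)
  have in_G: "e0 \<in> parcs G" "e1 \<in> parcs G" "e2 \<in> parcs G" "e3 \<in> parcs G"
    "e4 \<in> parcs G" "e5 \<in> parcs G"
    using sub es es_eq by auto
  have out3: False if "x \<in> parcs G" "y \<in> parcs G" "z \<in> parcs G" "distinct [x, y, z]"
    "fst y = fst x" "fst z = fst x" for x y z
    using card_2_cases[OF card_out_fibre[of x], of x y z] that by auto
  have in3: False if "x \<in> parcs G" "y \<in> parcs G" "z \<in> parcs G" "distinct [x, y, z]"
    "snd y = snd x" "snd z = snd x" for x y z
    using card_2_cases[OF card_in_fibre[of x], of x y z] that by auto
  show thesis
  proof (rule that[of "fst e1" "fst e3" "fst e5" "snd e0" "snd e2" "snd e4"])
    \<comment> \<open>If two tails coincided, three distinct arcs would start at one vertex, against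
      out-degree 2. The heads are treated dually.\<close>
    show "distinct [fst e1, fst e3, fst e5]"
      using out3[of e1 e2 e3] out3[of e1 e2 e5] out3[of e3 e4 e5] in_G dist ends by auto
    show "distinct [snd e0, snd e2, snd e4]"
      using in3[of e0 e1 e2] in3[of e0 e1 e4] in3[of e2 e3 e4] in_G dist ends by auto
    have arcs: "e0 = (fst e5, snd e0)" "e1 = (fst e1, snd e0)" "e2 = (fst e1, snd e2)"
      "e3 = (fst e3, snd e2)" "e4 = (fst e3, snd e4)" "e5 = (fst e5, snd e4)"
      using ends by (simp_all add: prod_eq_iff)
    have "A = {e0, e1, e2, e3, e4, e5}" by (simp add: es(2) es_eq)
    also have "\<dots> = {(fst e5, snd e0), (fst e1, snd e0), (fst e1, snd e2), (fst e3, snd e2),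
        (fst e3, snd e4), (fst e5, snd e4)}"
      by (intro arg_cong2[where f = insert] refl) (fact arcs)+
    finally show "A = \<dots>" .
  qed (fact sub)
qed

text \<open>A hexagon already contains two arcs at each of its heads and tails, and these exhaust
  the corresponding fibre of \<open>G\<close>.\<close>

lemma hexagon_closed:
  assumes "A \<in> ACs G" "card A = 6" "d \<in> A" "e \<in> parcs G" "fst e = fst d \<or> snd e = snd d"
  shows "e \<in> A"
proof -
  obtain a1 a2 a3 b1 b2 b3 where A: "distinct [a1, a2, a3]" "distinct [b1, b2, b3]"
    "A = {(a3, b1), (a1, b1), (a1, b2), (a2, b2), (a2, b3), (a3, b3)}" "A \<subseteq> parcs G"
    by (rule AC_hexagon[OF assms(1,2)])
  have d: "d \<in> parcs G" using A(4) assms(3) by (rule subsetD)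
  have partners: "\<forall>c \<in> A. (\<exists>d' \<in> A. d' \<noteq> c \<and> fst d' = fst c)
    \<and> (\<exists>d' \<in> A. d' \<noteq> c \<and> snd d' = snd c)"
    using A(1,2) unfolding A(3) by simp blast
  from assms(5) show ?thesis
  proof
    assume e: "fst e = fst d"
    obtain d' where "d' \<in> A" "d' \<noteq> d" "fst d' = fst d"
      using partners assms(3) by blast
    then show ?thesis
      using card_2_cases[OF card_out_fibre[OF d], of d d' e] d e assms(3,4) subsetD[OF A(4)]
      by auto
  next
    assume e: "snd e = snd d"
    obtain d' where "d' \<in> A" "d' \<noteq> d" "snd d' = snd d"
      using partners assms(3) by blast
    then show ?thesis
      using card_2_cases[OF card_in_fibre[OF d], of d d' e] d e assms(3,4) subsetD[OF A(4)]
      by auto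
  qed
qed

text \<open>From one shared arc, \<open>hexagon_closed\<close> carries membership in
  \<open>B\<close> all the way around \<open>A\<close>; equal cardinalities then turn inclusion into
  equality.\<close>

lemma hexagons_disjoint:
  assumes "A \<in> ACs G" "card A = 6" "B \<in> ACs G" "card B = 6" "e \<in> A" "e \<in> B"
  shows "A = B"
proof -
  obtain a1 a2 a3 b1 b2 b3 where A:
    "A = {(a3, b1), (a1, b1), (a1, b2), (a2, b2), (a2, b3), (a3, b3)}" "A \<subseteq> parcs G"
    using AC_hexagon[OF assms(1,2)] by metis
  have step: "d' \<in> B" if "d \<in> B" "d' \<in> A" "fst d' = fst d \<or> snd d' = snd d" for d d'
    using hexagon_closed[OF assms(3,4)] that A(2) by blast
  have cycle: "(a3, b1) \<in> B \<Longrightarrow> (a1, b1) \<in> B" "(a1, b1) \<in> B \<Longrightarrow> (a1, b2) \<in> B"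
    "(a1, b2) \<in> B \<Longrightarrow> (a2, b2) \<in> B" "(a2, b2) \<in> B \<Longrightarrow> (a2, b3) \<in> B"
    "(a2, b3) \<in> B \<Longrightarrow> (a3, b3) \<in> B" "(a3, b3) \<in> B \<Longrightarrow> (a3, b1) \<in> B"
    by (erule step; simp add: A(1))+
  have "A \<subseteq> B"
    using assms(5,6) cycle unfolding A(1) by blast
  moreover have "finite B" using assms(4) by (simp add: card_ge_0_finite)
  ultimately show ?thesis using assms(2,4) by (simp add: card_subset_eq)
qed

text \<open>Covering by \<open>arc_in_AC\<close> and disjointness of hexagons make the alternating
  cycles a partition of the arcs.\<close>

lemma Union_other_ACs:
  assumes "\<forall>A \<in> ACs G. card A = 6" "X \<in> ACs G"
  shows "\<Union>(ACs G - {X}) = parcs G - X"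
proof
  have "A \<subseteq> parcs G" if "A \<in> ACs G" for A
    using that by (auto simp: ACs_def alternating_cycle_def)
  then show "\<Union>(ACs G - {X}) \<subseteq> parcs G - X"
    using hexagons_disjoint assms by blast
  show "parcs G - X \<subseteq> \<Union>(ACs G - {X})"
    using arc_in_AC by blast
qed

section \<open>Factors as permutations\<close>

text \<open>Every vertex of a 2-dd has arcs in both directions. The unique chosen out-arc makes the
  factor the graph of a function, and the unique chosen in-arc makes that function
  bijective.\<close>

lemma factor_permutation:
  assumes "factor G F"
  obtains s where "s permutes pverts G" "parcs F = (\<lambda>v. (v, s v)) ` pverts G"
proof -
  let ?V = "pverts G"
  have sub: "parcs F \<subseteq> parcs G"
    using assms by (auto simp: factor_def spanning_def subgraph_def)
  have out1: "\<exists>!e. e \<in> out_arcs G v \<and> e \<in> parcs F" and in1: "\<exists>!e. e \<in> in_arcs G v \<and> e \<in> parcs F"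
    if "v \<in> ?V" for v
    using assms that in_arcs_nonempty out_arcs_nonempty by (auto simp: factor_def)
  have out_ex: "\<exists>w. (v, w) \<in> parcs F" and in_ex: "\<exists>u. (u, v) \<in> parcs F" if "v \<in> ?V" for v
    using out1[OF that] in1[OF that] by auto
  have out_uniq: "w = w'" if "(v, w) \<in> parcs F" "(v, w') \<in> parcs F" for v w w'
  proof -
    have "v \<in> ?V" using that sub in_arcsD1 by blast
    with out1[of v] show ?thesis using that sub by auto blast
  qed
  have in_uniq: "u = u'" if "(u, v) \<in> parcs F" "(u', v) \<in> parcs F" for u u' v
  proof -
    have "v \<in> ?V" using that sub in_arcsD2 by blast
    with in1[of v] show ?thesis using that sub by auto blast
  qed
  \<comment> \<open>The identity is the default off \<open>pverts G\<close>, as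
    \<open>permutes\<close> demands.\<close>
  define s where "s v = (if v \<in> ?V then THE w. (v, w) \<in> parcs F else v)" for v
  have s: "(v, s v) \<in> parcs F" if "v \<in> ?V" for v
    using theI'[of "\<lambda>w. (v, w) \<in> parcs F"] out_ex[OF that] out_uniq that
    unfolding s_def by auto
  have arcs: "parcs F = (\<lambda>v. (v, s v)) ` ?V"
  proof (intro set_eqI iffI)
    fix e assume e: "e \<in> parcs F"
    obtain v w where vw: "e = (v, w)" by (cases e)
    then have v: "v \<in> ?V" using e sub in_arcsD1 by blast
    with vw e have "e = (v, s v)" using out_uniq s by blast
    with v show "e \<in> (\<lambda>v. (v, s v)) ` ?V" by blast
  qed (use s in auto)
  have "s ` ?V = ?V"
  proof
    show "s ` ?V \<subseteq> ?V" using s sub in_arcsD2 by blast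
    show "?V \<subseteq> s ` ?V" using in_ex arcs by blast
  qed
  moreover have "inj_on s ?V"
    using s in_uniq by (intro inj_onI) metis
  ultimately have "s permutes ?V"
    by (intro bij_imp_permutes) (auto simp: bij_betw_def s_def)
  with arcs show thesis using that by blast
qed

end

section \<open>Orbits of a permutation as directed cycles\<close>

definition orbit_arcs :: "('a \<Rightarrow> 'a) \<Rightarrow> 'a \<Rightarrow> ('a \<times> 'a) set" where
  "orbit_arcs s v = (\<lambda>w. (w, s w)) ` orbit s v"

lemma orbit_eq_of_mem:
  assumes "permutation s" "x \<in> orbit s v"
  shows "orbit s x = orbit s v"
  using orbit_cyclic_eq3[OF cyclic_on_orbit'[OF assms(1)] assms(2)] .

lemma pcas_funpow:
  assumes "pcas u p w" "\<And>e. e \<in> set p \<Longrightarrow> snd e = s (fst e)"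
  shows "w = (s ^^ length p) u
    \<and> set p = (\<lambda>i. ((s ^^ i) u, (s ^^ Suc i) u)) ` {..<length p}"
  using assms
proof (induction p arbitrary: u)
  case (Cons e p)
  then have e: "e = (u, s u)" by (metis list.set_intros(1) pcas.simps(2) prod.collapse)
  with Cons have "w = (s ^^ length p) (s u)"
    "set p = (\<lambda>i. ((s ^^ i) (s u), (s ^^ Suc i) (s u))) ` {..<length p}"
    by auto
  then show ?case
    unfolding e by (simp add: funpow_swap1 lessThan_Suc_eq_insert_0 image_image)
qed simp

text \<open>A walk in \<open>F\<close> can only follow the iterates of \<open>s\<close>; if it
  returns to \<open>u\<close> after a positive number of steps, it has run through the whole
  orbit.\<close>

lemma cycle_is_orbit_arcs:
  assumes "pair_wf_digraph F" "pre_digraph.cycle F p" "\<And>e. e \<in> parcs F \<Longrightarrow> snd e = s (fst e)"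
  obtains v where "v \<in> pverts F" "set p = orbit_arcs s v"
proof -
  interpret F: pair_wf_digraph F by fact
  obtain u where u: "u \<in> pverts F" "set p \<subseteq> parcs F" "pcas u p u" "p \<noteq> []"
    using assms(2) by (auto simp: F.cycle_def F.awalk_def)
  then have "u = (s ^^ length p) u
    \<and> set p = (\<lambda>i. ((s ^^ i) u, (s ^^ Suc i) u)) ` {..<length p}"
    using assms(3) by (intro pcas_funpow) auto
  moreover from this have "orbit s u = {(s ^^ i) u | i. i < length p}"
    using u(4) by (intro orbit_altdef_bounded) auto
  ultimately have "set p = orbit_arcs s u"
    unfolding orbit_arcs_def by auto
  with u(1) show thesis using that by blast
qed

lemma orbit_arcs_is_cycle:
  assumes "pair_wf_digraph H" "permutation s" "orbit_arcs s v \<subseteq> parcs H"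
  obtains p where "pre_digraph.cycle H p" "set p = orbit_arcs s v"
proof -
  interpret H: pair_wf_digraph H by fact
  \<comment> \<open>The least positive return time of \<open>v\<close>, so the iterates below
    \<open>n\<close> are distinct.\<close>
  define n where "n = funpow_dist1 s v v"
  have v: "v \<in> orbit s v" using assms(2) by (rule permutation_self_in_orbit)
  have n: "0 < n" "(s ^^ n) v = v"
    using funpow_dist1_prop[OF v] unfolding n_def by auto
  have inj: "inj_on (\<lambda>i. (s ^^ i) v) {0..<n}"
    using inj_on_funpow_dist1[OF v] unfolding n_def .
  \<comment> \<open>\<open>q i\<close> is the final part of the closed walk from its
    \<open>i\<close>-th vertex on. The parameter permits a downward induction from the empty walk
    \<open>q n\<close>.\<close>
  define q where "q i = map (\<lambda>j. ((s ^^ j) v, (s ^^ Suc j) v)) [i..<n]" for i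
  have set_q: "set (q 0) = orbit_arcs s v"
    using orbit_altdef_bounded[OF n(2,1)] unfolding orbit_arcs_def q_def
    by (auto simp: image_iff)
  have cas: "pcas ((s ^^ i) v) (q i) v" if "i \<le> n" for i
    using that
  proof (induction rule: inc_induct)
    case base
    then show ?case using n by (simp add: q_def)
  next
    case (step i)
    then show ?case by (simp add: q_def upt_conv_Cons)
  qed
  have "(v, s v) \<in> parcs H" using assms(3) v by (auto simp: orbit_arcs_def)
  then have "v \<in> pverts H" by (rule H.in_arcsD1)
  then have walk: "H.awalk v (q 0) v"
    using cas[of 0] set_q assms(3) by (simp add: H.awalk_def)
  have "q 0 \<noteq> []" using n by (simp add: q_def)
  have "map fst (q 0) = map (\<lambda>j. (s ^^ j) v) [0..<n]"
    by (simp add: q_def o_def)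
  then have d: "distinct (map fst (q 0))"
    using inj by (simp add: distinct_map)
  \<comment> \<open>\<open>cycle\<close> asks for distinct vertices after dropping the first one.
    The walk starts and ends at \<open>v\<close>, so what remains is a rotation of the distinct list
    of tails.\<close>
  have "pawalk_verts v (q 0) = map fst (q 0) @ [snd (last (q 0))]"
    using H.awalk_verts_conv[of v "q 0"] \<open>q 0 \<noteq> []\<close> by simp
  moreover have "snd (last (q 0)) = v" using n by (cases n) (simp_all add: q_def)
  moreover have "hd (map fst (q 0)) = v" using n by (simp add: q_def hd_map)
  ultimately have "distinct (tl (pawalk_verts v (q 0)))"
    using d \<open>q 0 \<noteq> []\<close> by (cases "q 0") auto
  with walk \<open>q 0 \<noteq> []\<close> have "H.cycle (q 0)" by (auto simp: H.cycle_def)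
  with set_q show thesis using that by blast
qed

lemma factor_wf:
  assumes "factor G F"
  shows "pair_wf_digraph F" "parcs F \<subseteq> parcs G" "pverts F = pverts G"
  using assms by (auto simp: factor_def spanning_def subgraph_def wf_digraph_wp_iff)

text \<open>\<open>card\<close> is also 0 on infinite sets; finitely many arcs ensure that index 0
  really means that there is no cycle.\<close>

lemma open_factor_no_cycle:
  assumes "pair_wf_digraph F" "finite (parcs F)" "open_factor F"
  shows "\<not> pre_digraph.cycle F p"
proof -
  interpret F: pair_wf_digraph F by fact
  have "set ` {p. F.cycle p} \<subseteq> Pow (parcs F)"
    by (auto simp: F.cycle_def F.awalk_def)
  then have "finite (set ` {p. F.cycle p})"
    using assms(2) by (meson finite_Pow_iff finite_subset)
  then show ?thesis
    using assms(3) by (auto simp: open_factor_def factor_index_def)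
qed

section \<open>Counting the cycles of a factor by orbits\<close>

context two_dd
begin

lemma cycles_of_factor:
  assumes "factor G F" "s permutes pverts G" "parcs F = (\<lambda>v. (v, s v)) ` pverts G"
  shows "set ` {p. pre_digraph.cycle F p} = orbit_arcs s ` pverts G"
proof (intro set_eqI iffI)
  fix c assume "c \<in> set ` {p. pre_digraph.cycle F p}"
  then obtain p where p: "pre_digraph.cycle F p" "c = set p" by auto
  have "\<And>e. e \<in> parcs F \<Longrightarrow> snd e = s (fst e)" using assms(3) by auto
  then obtain v where "v \<in> pverts F" "set p = orbit_arcs s v"
    using cycle_is_orbit_arcs[OF factor_wf(1)[OF assms(1)] p(1)] by blast
  with p factor_wf(3)[OF assms(1)] show "c \<in> orbit_arcs s ` pverts G" by auto
next
  fix c assume "c \<in> orbit_arcs s ` pverts G"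
  then obtain v where v: "v \<in> pverts G" "c = orbit_arcs s v" by auto
  have "permutation s" using assms(2) pair_finite_verts permutation_permutes by blast
  moreover have "orbit_arcs s v \<subseteq> parcs F"
    using permutes_orbit_subset[OF assms(2) v(1)] assms(3) by (auto simp: orbit_arcs_def)
  ultimately obtain p where "pre_digraph.cycle F p" "set p = c"
    using orbit_arcs_is_cycle[OF factor_wf(1)[OF assms(1)]] v(2) by metis
  then show "c \<in> set ` {p. pre_digraph.cycle F p}" by auto
qed

text \<open>An orbit avoiding the tails of \<open>Z\<close> would be a cycle of the open
  \<open>P\<close>. Hence the index is at most 3; being odd and not 1, it equals 3, so the three
  tails lie on three different cycles.\<close>

lemma orbits_separate_tails:
  assumes "odd_two_dd G" "\<not> Hamiltonian G"
    and F: "factor G F" "s permutes pverts G" "parcs F = (\<lambda>v. (v, s v)) ` pverts G"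
    and P: "pair_wf_digraph P" "finite (parcs P)" "open_factor P" "parcs F = parcs P \<union> Z"
    and Z: "card (fst ` Z) = 3"
    and xy: "x \<in> fst ` Z" "y \<in> fst ` Z" "x \<in> orbit s y"
  shows "x = y"
proof -
  let ?T = "fst ` Z"
  have perm: "permutation s" using F(2) pair_finite_verts permutation_permutes by blast
  have T_sub: "?T \<subseteq> pverts G"
    using P(4) F(3) by auto
  have meets: "\<exists>w \<in> ?T. w \<in> orbit s v" if "v \<in> pverts G" for v
  proof (rule ccontr)
    assume "\<not> ?thesis"
    then have "orbit_arcs s v \<inter> Z = {}" by (force simp: orbit_arcs_def)
    moreover have "orbit_arcs s v \<subseteq> parcs F"
      using permutes_orbit_subset[OF F(2) that] F(3) by (auto simp: orbit_arcs_def)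
    ultimately have "orbit_arcs s v \<subseteq> parcs P" using P(4) by blast
    then show False
      using orbit_arcs_is_cycle[OF P(1) perm] open_factor_no_cycle[OF P(1-3)] by blast
  qed
  have images: "orbit_arcs s ` pverts G = orbit_arcs s ` ?T"
  proof
    show "orbit_arcs s ` pverts G \<subseteq> orbit_arcs s ` ?T"
    proof
      fix c assume "c \<in> orbit_arcs s ` pverts G"
      then obtain v where v: "v \<in> pverts G" "c = orbit_arcs s v" by auto
      obtain w where w: "w \<in> ?T" "w \<in> orbit s v" using meets[OF v(1)] by blast
      have "c = orbit_arcs s w"
        using orbit_eq_of_mem[OF perm w(2)] v(2) by (simp add: orbit_arcs_def)
      with w(1) show "c \<in> orbit_arcs s ` ?T" by blast
    qed
  qed (use T_sub in auto)
  have index: "factor_index F = card (orbit_arcs s ` ?T)"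
    unfolding factor_index_def using cycles_of_factor[OF F] images by simp
  have fin: "finite ?T" using Z by (simp add: card_ge_0_finite)
  have "card (orbit_arcs s ` ?T) \<le> 3" using card_image_le[OF fin] Z by metis
  moreover have "odd (card (orbit_arcs s ` ?T))"
    using assms(1) F(1) index unfolding odd_two_dd_def by metis
  \<comment> \<open>A single orbit would pass through every vertex and so be a Hamiltonian cycle of
    \<open>G\<close>.\<close>
  moreover have "card (orbit_arcs s ` ?T) \<noteq> 1"
  proof
    assume "card (orbit_arcs s ` ?T) = 1"
    then obtain c where c: "orbit_arcs s ` ?T = {c}" by (rule card_1_singletonE)
    have all: "orbit_arcs s v = c" if "v \<in> pverts G" for v
      using imageI[OF that, of "orbit_arcs s"] unfolding images c by (rule singletonD)
    have y: "y \<in> pverts G" using xy(2) T_sub by blast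
    have "orbit_arcs s y \<subseteq> parcs G"
      using permutes_orbit_subset[OF F(2) y] F(3) factor_wf(2)[OF F(1)]
      by (auto simp: orbit_arcs_def)
    then obtain p where p: "pre_digraph.cycle G p" "set p = orbit_arcs s y"
      using orbit_arcs_is_cycle[OF pair_wf_digraph_axioms perm] by metis
    have "\<exists>e \<in> set p. fst e = v" if "v \<in> pverts G" for v
    proof -
      have "(v, s v) \<in> orbit_arcs s v"
        using permutation_self_in_orbit[OF perm] by (auto simp: orbit_arcs_def)
      then show ?thesis using all that y p(2) by force
    qed
    with p(1) have "Hamiltonian G" unfolding Hamiltonian_def by blast
    with assms(2) show False by blast
  qed
  moreover have "k = 3" if "k \<le> 3" "odd k" "k \<noteq> 1" for k :: nat
    using that by presburger
  ultimately have "card (orbit_arcs s ` ?T) = card ?T" using Z by metis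
  then have "inj_on (orbit_arcs s) ?T" using eq_card_imp_inj_on[OF fin] by blast
  moreover have "orbit_arcs s x = orbit_arcs s y"
    using orbit_eq_of_mem[OF perm xy(3)] by (simp add: orbit_arcs_def)
  ultimately show ?thesis using xy by (auto dest: inj_onD)
qed

section \<open>Completing a factor of the complement by a matching of \<open>X\<close>\<close>

lemma ex1_same_image:
  assumes "inj_on f Z" "f ` Z = f ` X" "e \<in> X"
  shows "\<exists>!d. d \<in> Z \<and> f d = f e"
proof -
  obtain d where "d \<in> Z" "f d = f e" using assms(2,3) by (metis image_iff)
  then show ?thesis using assms(1) by (metis inj_onD)
qed

text \<open>By \<open>hexagon_closed\<close> the two in-arcs of a vertex lie both in
  \<open>X\<close> or both outside it, so the single chosen one comes from \<open>Z\<close> or from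
  \<open>P\<close> accordingly. The same holds independently for the out-arcs.\<close>

lemma factor_extension:
  assumes six: "\<forall>A \<in> ACs G. card A = 6" and X: "X \<in> ACs G"
    and P: "factor (AC_subgraph (ACs G - {X})) P"
    and Z: "Z \<subseteq> X" "inj_on fst Z" "fst ` Z = fst ` X" "inj_on snd Z" "snd ` Z = snd ` X"
  shows "factor G \<lparr>pverts = pverts G, parcs = parcs P \<union> Z\<rparr>" (is "factor G ?F")
proof -
  let ?H = "AC_subgraph (ACs G - {X})"
  note U = Union_other_ACs[OF six X]
  have X_sub: "X \<subseteq> parcs G" using X by (auto simp: ACs_def alternating_cycle_def)
  have closed: "e \<in> X" if "d \<in> X" "e \<in> parcs G" "fst e = fst d \<or> snd e = snd d" for d e
    using hexagon_closed[OF X _ that] six X by blast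
  have P_sub: "parcs P \<subseteq> parcs G - X"
    using factor_wf(2)[OF P] U by (simp add: AC_subgraph_def)
  have H: "pverts ?H = fst ` (parcs G - X) \<union> snd ` (parcs G - X)" "parcs ?H = parcs G - X"
    using U by (auto simp: AC_subgraph_def)
  have F_sub: "parcs ?F \<subseteq> parcs G" using P_sub Z(1) X_sub by auto
  have "pair_wf_digraph ?F"
  proof
    fix e assume "e \<in> parcs ?F"
    then have "e \<in> parcs G" using F_sub by blast
    then show "fst e \<in> pverts ?F" "snd e \<in> pverts ?F"
      using arc_fst_in_verts arc_snd_in_verts by simp_all
  qed
  then have spanning: "spanning ?F G"
    using F_sub pair_wf_digraph_axioms
    by (auto simp: spanning_def subgraph_def wf_digraph_wp_iff compatible_def)
  have "\<exists>!e. e \<in> in_arcs G v \<and> e \<in> parcs ?F" if "v \<in> pverts G" for v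
  proof -
    from in_arcs_nonempty[OF that] obtain e0 where e0: "e0 \<in> parcs G" "snd e0 = v"
      by (auto simp: in_arcs_def)
    show ?thesis
    proof (cases "e0 \<in> X")
      case True
      have "e \<in> in_arcs G v \<and> e \<in> parcs ?F \<longleftrightarrow> e \<in> Z \<and> snd e = snd e0" for e
        using closed[OF True, of e] P_sub Z(1) X_sub e0 by auto
      then show ?thesis using ex1_same_image[OF Z(4,5) True] by simp
    next
      case False
      then have "e0 \<in> in_arcs ?H v" "v \<in> pverts ?H" using H e0 by auto
      then have "\<exists>!e. e \<in> in_arcs ?H v \<and> e \<in> parcs P"
        using P unfolding factor_def by blast
      moreover have "e \<in> in_arcs G v \<and> e \<in> parcs ?F \<longleftrightarrow> e \<in> in_arcs ?H v \<and> e \<in> parcs P" for e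
        using closed[of e e0] P_sub Z(1) H e0 False by auto
      ultimately show ?thesis by simp
    qed
  qed
  moreover have "\<exists>!e. e \<in> out_arcs G v \<and> e \<in> parcs ?F" if "v \<in> pverts G" for v
  proof -
    from out_arcs_nonempty[OF that] obtain e0 where e0: "e0 \<in> parcs G" "fst e0 = v"
      by (auto simp: out_arcs_def)
    show ?thesis
    proof (cases "e0 \<in> X")
      case True
      have "e \<in> out_arcs G v \<and> e \<in> parcs ?F \<longleftrightarrow> e \<in> Z \<and> fst e = fst e0" for e
        using closed[OF True, of e] P_sub Z(1) X_sub e0 by auto
      then show ?thesis using ex1_same_image[OF Z(2,3) True] by simp
    next
      case False
      then have "e0 \<in> out_arcs ?H v" "v \<in> pverts ?H" using H e0 by auto
      then have "\<exists>!e. e \<in> out_arcs ?H v \<and> e \<in> parcs P"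
        using P unfolding factor_def by blast
      moreover have "e \<in> out_arcs G v \<and> e \<in> parcs ?F \<longleftrightarrow> e \<in> out_arcs ?H v \<and> e \<in> parcs P" for e
        using closed[of e e0] P_sub Z(1) H e0 False by auto
      ultimately show ?thesis by simp
    qed
  qed
  ultimately show ?thesis using spanning unfolding factor_def by blast
qed

end

text \<open>From \<open>b\<close> both permutations run along the same path until it first hits \<open>T\<close>.\<close>

lemma same_first_hit:
  assumes "permutation s" "\<And>x. x \<notin> T \<Longrightarrow> s' x = s x"
    and a: "a \<in> T" "s a = b" "\<And>x. x \<in> T \<Longrightarrow> x \<in> orbit s a \<Longrightarrow> x = a"
    and a': "s' a' = b" "\<And>x. x \<in> T \<Longrightarrow> x \<in> orbit s' a' \<Longrightarrow> x = a'"
  shows "a = a'"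
proof -
  have "a \<in> orbit s b"
    using permutation_orbit_step[OF assms(1), of a] permutation_self_in_orbit[OF assms(1), of a] a(2)
    by simp
  then have ex: "\<exists>n. (s ^^ n) b \<in> T" using a(1) by (auto simp: orbit_altdef)
  \<comment> \<open>The first hit may be at \<open>n = 0\<close>, when \<open>b\<close> itself lies
    in \<open>T\<close>: the path from \<open>b\<close> is then trivial.\<close>
  define n where "n = (LEAST n. (s ^^ n) b \<in> T)"
  have hit: "(s ^^ n) b \<in> T" unfolding n_def using ex by (rule LeastI_ex)
  have before: "(s ^^ k) b \<notin> T" if "k < n" for k
    using that not_less_Least unfolding n_def by blast
  have agree: "(s' ^^ k) b = (s ^^ k) b" if "k \<le> n" for k
    using that by (induction k) (auto simp: before assms(2))
  have "(s ^^ n) b \<in> orbit s a"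
    using a(2) orbit.base[of s a] funpow_in_orbit by metis
  moreover have "(s' ^^ n) b \<in> orbit s' a'"
    using a'(1) orbit.base[of s' a'] funpow_in_orbit by metis
  \<comment> \<open>The common first hit lies in \<open>T\<close> and on the cycles of both
    \<open>a\<close> and \<open>a'\<close>, each of which meets \<open>T\<close> only once.\<close>
  ultimately have "(s ^^ n) b = a" "(s ^^ n) b = a'"
    using hit a(3) a'(2) agree[of n] by auto
  then show ?thesis by simp
qed

section \<open>Comparison of the two perfect matchings of \<open>X\<close>\<close>

theorem proposition6:
  fixes G :: "'a pair_pre_digraph"
  assumes "two_dd G"
    and "\<forall>A \<in> ACs G. card A = 6"
    and "connected G"
    and "odd_two_dd G"
    and "\<not> Hamiltonian G"
  shows "\<forall>X \<in> ACs G. open_AC X \<longrightarrow> closed_ACs (ACs G - {X})"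
proof (intro ballI impI)
  interpret two_dd G by fact
  fix X assume X: "X \<in> ACs G"
  show "closed_ACs (ACs G - {X})"
    unfolding closed_ACs_def closed_two_digraph_def
  proof (intro allI impI notI)
    fix P assume P: "factor (AC_subgraph (ACs G - {X})) P" and op: "open_factor P"
    have P_sub: "parcs P \<subseteq> parcs G - X"
      using factor_wf(2)[OF P] Union_other_ACs[OF assms(2) X] by (simp add: AC_subgraph_def)
    have P_fin: "finite (parcs P)"
      using P_sub pair_finite_arcs by (meson finite_Diff finite_subset)
    obtain a1 a2 a3 b1 b2 b3 where dist: "distinct [a1, a2, a3]" "distinct [b1, b2, b3]"
      and X_eq: "X = {(a3, b1), (a1, b1), (a1, b2), (a2, b2), (a2, b3), (a3, b3)}"
      using AC_hexagon[OF X bspec[OF assms(2) X]] by metis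
    let ?T = "{a1, a2, a3}"
    \<comment> \<open>\<open>M\<close> and \<open>N\<close> take alternate arcs of the hexagon, so
      each uses every tail and every head exactly once.\<close>
    define M where "M = {(a3, b1), (a1, b2), (a2, b3)}"
    define N where "N = {(a1, b1), (a2, b2), (a3, b3)}"
    let ?F = "\<lambda>Z. \<lparr>pverts = pverts G, parcs = parcs P \<union> Z\<rparr>"
    have MN: "M \<subseteq> X" "inj_on fst M" "fst ` M = fst ` X" "inj_on snd M" "snd ` M = snd ` X"
      "N \<subseteq> X" "inj_on fst N" "fst ` N = fst ` X" "inj_on snd N" "snd ` N = snd ` X"
      using dist by (auto simp: X_eq M_def N_def)
    have F: "factor G (?F M)" "factor G (?F N)"
      using factor_extension[OF assms(2) X P] MN by blast+
    obtain s where s: "s permutes pverts G" "parcs (?F M) = (\<lambda>v. (v, s v)) ` pverts G"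
      using factor_permutation[OF F(1)] by blast
    obtain s' where s': "s' permutes pverts G" "parcs (?F N) = (\<lambda>v. (v, s' v)) ` pverts G"
      using factor_permutation[OF F(2)] by blast
    have T: "fst ` M = ?T" "fst ` N = ?T" by (auto simp: M_def N_def)
    have card_T: "card ?T = 3" using dist by simp
    have sep: "x = y" if "x \<in> ?T" "y \<in> ?T" "x \<in> orbit s y" for x y
      using orbits_separate_tails[OF assms(4,5) F(1) s factor_wf(1)[OF P] P_fin op, of M x y]
        that T card_T by simp
    have sep': "x = y" if "x \<in> ?T" "y \<in> ?T" "x \<in> orbit s' y" for x y
      using orbits_separate_tails[OF assms(4,5) F(2) s' factor_wf(1)[OF P] P_fin op, of N x y]
        that T card_T by simp
    have arcs: "parcs P \<union> M = (\<lambda>v. (v, s v)) ` pverts G"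
      "parcs P \<union> N = (\<lambda>v. (v, s' v)) ` pverts G"
      using s(2) s'(2) by simp_all
    have s_eq: "s v = w" if "(v, w) \<in> parcs P \<union> M" for v w
      using that unfolding arcs by auto
    have s'_eq: "s' v = w" if "(v, w) \<in> parcs P \<union> N" for v w
      using that unfolding arcs by auto
    \<comment> \<open>Outside \<open>?T\<close> the chosen out-arc belongs to \<open>P\<close>,
      which both factors share; off \<open>pverts G\<close> both permutations are the
      identity.\<close>
    have agree: "s' v = s v" if "v \<notin> ?T" for v
    proof (cases "v \<in> pverts G")
      case True
      then have "(v, s v) \<in> parcs P \<union> M" unfolding arcs by simp
      moreover have "(v, s v) \<notin> M" using that by (auto simp: M_def)
      ultimately show ?thesis using s'_eq by blast
    next
      case False
      then show ?thesis using s(1) s'(1) by (simp add: permutes_def)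
    qed
    \<comment> \<open>\<open>a3\<close> and \<open>a1\<close> are the partners of \<open>b1\<close>
      in \<open>M\<close> and in \<open>N\<close>; the common path from \<open>b1\<close> would have
      to end at both.\<close>
    have "a3 = a1"
    proof (rule same_first_hit)
      show "permutation s" using s(1) pair_finite_verts permutation_permutes by blast
      show "s' x = s x" if "x \<notin> ?T" for x using that by (rule agree)
      show "s a3 = b1" by (rule s_eq) (simp add: M_def)
      show "s' a1 = b1" by (rule s'_eq) (simp add: N_def)
      show "x = a3" if "x \<in> ?T" "x \<in> orbit s a3" for x using that by (intro sep) simp_all
      show "x = a1" if "x \<in> ?T" "x \<in> orbit s' a1" for x using that by (intro sep') simp_all
    qed simp
    then show False using dist by simp
  qed
qed

end
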